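(* Let $\lambda\in\mathbb{K}^*$. The curve defined by the polynomial $f= x(x-y^2)^2-2\lambda y(x-y^2)+\lambda^2$ is Cremona equivalent to a line.
   Context: $\mathbb{K}$ is an algebraically closed field of characteristic zero. A plane curve is Cremona equivalent to a line if there is a birational transformation of the plane (an element of $\mathrm{Bir}(\mathbb{A}^2)=\mathrm{Bir}(\mathbb{P}^2)$) mapping the (closure in $\mathbb{P}^2$ of the) curve birationally onto a line of $\mathbb{P}^2$. *)

theory Defs
  imports "HOL-Analysis.Analysis" "HOL-Library.Poly_Mapping"
    "HOL-Computational_Algebra.Polynomial"
begin

section \<open>Polynomials in finitely many variables\<close>

text \<open>A polynomial with variables indexed by the finite type \<open>'n\<close> maps each exponent vector to its
  coefficient; the ring structure is the one of \<open>Poly_Mapping\<close>.\<close>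

type_synonym ('k, 'n) mpoly = "('n \<Rightarrow>\<^sub>0 nat) \<Rightarrow>\<^sub>0 'k"

definition PVar :: "'n \<Rightarrow> ('k::comm_ring_1, 'n) mpoly" where
  "PVar i = Poly_Mapping.single (Poly_Mapping.single i 1) 1"

definition PConst :: "'k \<Rightarrow> ('k::comm_ring_1, 'n) mpoly" where
  "PConst c = Poly_Mapping.single 0 c"

definition peval :: "('k::comm_ring_1, 'n::finite) mpoly \<Rightarrow> 'k ^ 'n \<Rightarrow> 'k" where
  "peval p v = (\<Sum>m\<in>Poly_Mapping.keys p.
      Poly_Mapping.lookup p m * (\<Prod>i\<in>UNIV. (v $ i) ^ Poly_Mapping.lookup m i))"

definition homogeneous :: "nat \<Rightarrow> ('k::comm_ring_1, 'n::finite) mpoly \<Rightarrow> bool" where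
  "homogeneous d p \<longleftrightarrow>
     (\<forall>m\<in>Poly_Mapping.keys p. (\<Sum>i\<in>UNIV. Poly_Mapping.lookup m i) = d)"


section \<open>Projective space and its Zariski topology\<close>

text \<open>A point of projective space is represented by the set of all its homogeneous coordinate
  vectors, i.e. a line through the origin with the origin removed.  With coordinates indexed by
  \<open>'n\<close> the projective space has dimension \<open>CARD('n) - 1\<close>.\<close>

type_synonym ('k, 'n) ppoint = "('k ^ 'n) set"

definition ppoint :: "'k::field ^ 'n::finite \<Rightarrow> ('k, 'n) ppoint" where
  "ppoint v = {c *s v | c. c \<noteq> 0}"

definition proj_space :: "('k::field, 'n::finite) ppoint set" where
  "proj_space = {ppoint v | v. v \<noteq> 0}"

definition basic_open :: "('k::field, 'n::finite) mpoly \<Rightarrow> ('k, 'n) ppoint set" where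
  "basic_open F = {P \<in> proj_space. \<forall>v\<in>P. peval F v \<noteq> 0}"

text \<open>The constant form 1 makes the whole projective space one of the generating open sets.\<close>

definition zariski :: "('k::field, 'n::finite) ppoint topology" where
  "zariski = topology_generated_by {basic_open F | F d. homogeneous d F}"

definition dense_open_in :: "('k::field, 'n::finite) ppoint set \<Rightarrow> ('k, 'n) ppoint set \<Rightarrow> bool" where
  "dense_open_in X U \<longleftrightarrow> openin (subtopology zariski X) U \<and> X \<subseteq> zariski closure_of U"


section \<open>Regular and birational maps\<close>

text \<open>Near each point of \<open>X\<close> the map is given by a tuple of forms of a common degree without
  common zeros.  The absence of common zeros is implied by \<open>\<phi> Q\<close> being a point of
  projective space, since such a set does not contain the zero vector.\<close>

definition regular_on ::
    "('k::field, 'n::finite) ppoint set \<Rightarrow> (('k, 'n) ppoint \<Rightarrow> ('k, 'm::finite) ppoint) \<Rightarrow> bool" where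
  "regular_on X \<phi> \<longleftrightarrow>
     (\<forall>P\<in>X. \<phi> P \<in> proj_space \<and>
        (\<exists>W d F. openin zariski W \<and> P \<in> W \<and> (\<forall>i. homogeneous d (F i)) \<and>
           (\<forall>Q\<in>W \<inter> X. \<forall>v\<in>Q. (\<chi> i. peval (F i) v) \<in> \<phi> Q)))"

definition iso_between ::
    "('k::field, 'n::finite) ppoint set \<Rightarrow> ('k, 'm::finite) ppoint set
      \<Rightarrow> (('k, 'n) ppoint \<Rightarrow> ('k, 'm) ppoint) \<Rightarrow> bool" where
  "iso_between U V \<phi> \<longleftrightarrow>
     bij_betw \<phi> U V \<and> regular_on U \<phi> \<and> regular_on V (inv_into U \<phi>)"

text \<open>A rational map is given by a map \<open>\<phi>\<close> whose values matter only on a set \<open>D\<close>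
  where it is regular.  It maps \<open>X\<close> birationally onto \<open>Y\<close> if \<open>D\<close> contains a dense open subset
  of \<open>X\<close> that \<open>\<phi>\<close> maps isomorphically onto a dense open subset of \<open>Y\<close>.\<close>

definition maps_birationally ::
    "('k::field, 'n::finite) ppoint set \<Rightarrow> (('k, 'n) ppoint \<Rightarrow> ('k, 'm::finite) ppoint)
      \<Rightarrow> ('k, 'n) ppoint set \<Rightarrow> ('k, 'm) ppoint set \<Rightarrow> bool" where
  "maps_birationally D \<phi> X Y \<longleftrightarrow>
     (\<exists>U V. U \<subseteq> D \<and> dense_open_in X U \<and> dense_open_in Y V \<and> iso_between U V \<phi>)"

definition cremona_transformation ::
    "('k::field, 3) ppoint set \<Rightarrow> (('k, 3) ppoint \<Rightarrow> ('k, 3) ppoint) \<Rightarrow> bool" where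
  "cremona_transformation D \<phi> \<longleftrightarrow>
     dense_open_in proj_space D \<and> regular_on D \<phi> \<and> maps_birationally D \<phi> proj_space proj_space"


section \<open>Plane curves\<close>

definition proj_line :: "('k::field, 3) ppoint set \<Rightarrow> bool" where
  "proj_line L \<longleftrightarrow>
     (\<exists>a. a \<noteq> 0 \<and> L = {P \<in> proj_space. \<forall>v\<in>P. (\<Sum>i\<in>UNIV. a $ i * v $ i) = 0})"

definition affine_curve :: "('k::field, 2) mpoly \<Rightarrow> ('k ^ 2) set" where
  "affine_curve f = {v. peval f v = 0}"

definition affine_to_proj :: "'k::field ^ 2 \<Rightarrow> ('k, 3) ppoint" where
  "affine_to_proj v = ppoint (vector [v $ 1, v $ 2, 1])"

definition proj_closure :: "('k::field ^ 2) set \<Rightarrow> ('k, 3) ppoint set" where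
  "proj_closure C = zariski closure_of (affine_to_proj ` C)"

definition cremona_equivalent_to_line :: "('k::field ^ 2) set \<Rightarrow> bool" where
  "cremona_equivalent_to_line C \<longleftrightarrow>
     (\<exists>D \<phi> L. cremona_transformation D \<phi> \<and> proj_line L \<and> maps_birationally D \<phi> (proj_closure C) L)"

end

theory Submission
  imports Defs
begin

text \<open>In the affine plane put \<open>u = x - y\<^sup>2\<close>.  Then \<open>f = u\<^sup>3 + (y u - \<lambda>)\<^sup>2\<close>, which is a cuspidal cubic in
  \<open>u\<close> and \<open>w = y u - \<lambda>\<close>.  Its usual parameter \<open>t = w / u = y - \<lambda> / u\<close> gives \<open>f = u\<^sup>2 s\<close> with
  \<open>s = u + t\<^sup>2\<close>, and on the curve \<open>u\<close> has no zero because \<open>f = \<lambda>\<^sup>2 \<noteq> 0\<close> where \<open>u = 0\<close>.  So the map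
  \<open>(x, y) \<mapsto> (s, t)\<close> takes the curve to the line \<open>s = 0\<close>.

  This map is birational.  As \<open>s - t\<^sup>2 = u\<close>, one recovers \<open>y = t + \<lambda> / u\<close> and \<open>x = u + y\<^sup>2\<close> from \<open>s\<close> and
  \<open>t\<close>: the inverse is the map of the same shape for \<open>- \<lambda>\<close>, and both preserve \<open>u\<close>.  Hence the map is
  an automorphism of the open set \<open>u \<noteq> 0\<close> of the affine plane (lemmas \<open>transf_in_chart\<close> and
  \<open>transf_transf\<close>).  In homogeneous coordinates it is given by three forms of degree six, whose first
  one vanishes on this open set exactly at the points of the curve.  Therefore it restricts to an
  isomorphism between the parts of the curve and of the line that lie in the open set
  (\<open>iso_between_transf\<close>).

  It remains to see that the open set meets the plane, the line and the closure of the curve in dense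
  subsets.  For the closure this is clear since the curve itself lies in the open set; for the plane
  and the line it is the irreducibility of linear subspaces
  (\<open>basic_open_dense_in_linear_section\<close>).\<close>

section \<open>Evaluation and homogeneity of polynomials\<close>

lemma mpoly_add_induct [case_names zero single add]:
  assumes "P 0" "\<And>m c. P (Poly_Mapping.single m c)" "\<And>p q. P p \<Longrightarrow> P q \<Longrightarrow> P (p + q)"
  shows "P (p :: 'a \<Rightarrow>\<^sub>0 'b::comm_monoid_add)"
proof (induction p rule: Poly_Mapping.update_induct)
  case const
  show ?case by (rule assms(1))
next
  case (update f a b)
  have "Poly_Mapping.update a b f = f + Poly_Mapping.single a b"
    using update.hyps(1)
    by (intro poly_mapping_eqI)
      (auto simp: lookup_update lookup_add lookup_single when_def in_keys_iff)
  thus ?case using update.IH assms(2,3) by simp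
qed

lemma peval_zero [simp]: "peval 0 v = 0"
  by (simp add: peval_def)

lemma peval_single:
  "peval (Poly_Mapping.single m c) v = c * (\<Prod>i\<in>UNIV. (v $ i) ^ Poly_Mapping.lookup m i)"
  by (simp add: peval_def)

lemma peval_add [simp]: "peval (p + q) v = peval p v + peval q v"
  unfolding peval_def by (rule setsum_keys_plus_distrib) (simp_all add: distrib_right)

lemma peval_uminus [simp]: "peval (- p) v = - peval p v"
  using peval_add[of p "- p" v] by (simp add: eq_neg_iff_add_eq_0 add.commute)

lemma peval_diff [simp]: "peval (p - q) v = peval p v - peval q v"
  using peval_add[of p "- q" v] by simp

lemma peval_mult [simp]: "peval (p * q) v = peval p v * peval q v"
proof (induction p rule: mpoly_add_induct)
  case (single m c)
  show ?case
  proof (induction q rule: mpoly_add_induct)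
    case (single n d)
    show ?case
      by (simp add: mult_single peval_single lookup_add power_add prod.distrib ac_simps)
  qed (simp_all add: distrib_left)
qed (simp_all add: distrib_right)

lemma peval_PConst [simp]: "peval (PConst c) v = c"
  by (simp add: PConst_def peval_single)

lemma peval_PVar [simp]: "peval (PVar i) v = v $ i"
proof -
  have "(\<Prod>j\<in>UNIV. (v $ j) ^ Poly_Mapping.lookup (Poly_Mapping.single i 1) j)
        = (\<Prod>j\<in>UNIV. if j = i then v $ j else 1)"
    by (intro prod.cong) (auto simp: lookup_single when_def)
  thus ?thesis by (simp add: PVar_def peval_single)
qed

lemma one_eq_PConst: "1 = PConst 1"
  by (simp add: PConst_def)

lemma peval_one [simp]: "peval 1 v = 1"
  by (simp add: one_eq_PConst del: single_one)

lemma peval_power [simp]: "peval (p ^ n) v = peval p v ^ n"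
  by (induction n) simp_all

lemma peval_two [simp]: "peval 2 v = 2"
  using peval_add[of 1 1 v] by simp

lemma homogeneous_PVar: "homogeneous 1 (PVar i)"
  by (auto simp: homogeneous_def PVar_def lookup_single when_def)

lemma homogeneous_PConst: "homogeneous 0 (PConst c)"
  by (auto simp: homogeneous_def PConst_def)

lemma homogeneous_add: "homogeneous d p \<Longrightarrow> homogeneous d q \<Longrightarrow> homogeneous d (p + q)"
  using Poly_Mapping.keys_add[of p q] unfolding homogeneous_def by blast

lemma homogeneous_diff: "homogeneous d p \<Longrightarrow> homogeneous d q \<Longrightarrow> homogeneous d (p - q)"
  using keys_diff[of p q] unfolding homogeneous_def by blast

lemma homogeneous_mult:
  assumes "homogeneous d p" "homogeneous e q" "n = d + e"
  shows "homogeneous n (p * q)"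
  unfolding homogeneous_def
proof
  fix m assume "m \<in> Poly_Mapping.keys (p * q)"
  then obtain a b where "m = a + b" "a \<in> Poly_Mapping.keys p" "b \<in> Poly_Mapping.keys q"
    using keys_mult[of p q] by blast
  thus "(\<Sum>i\<in>UNIV. Poly_Mapping.lookup m i) = n"
    using assms by (simp add: homogeneous_def lookup_add sum.distrib)
qed

lemma homogeneous_power:
  assumes "homogeneous d p" "n = k * d"
  shows "homogeneous n (p ^ k)"
  unfolding assms(2)
proof (induction k)
  case 0
  show ?case using homogeneous_PConst[of 1] by (simp add: one_eq_PConst del: single_one)
qed (auto intro: homogeneous_mult assms(1))

lemma peval_scale:
  assumes "homogeneous d p"
  shows "peval p (c *s v) = c ^ d * peval p v"
proof -
  have "(\<Prod>i\<in>UNIV. ((c *s v) $ i) ^ Poly_Mapping.lookup m i)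
        = c ^ d * (\<Prod>i\<in>UNIV. (v $ i) ^ Poly_Mapping.lookup m i)"
    if "m \<in> Poly_Mapping.keys p" for m
  proof -
    have "(\<Sum>i\<in>UNIV. Poly_Mapping.lookup m i) = d"
      using assms that by (simp add: homogeneous_def)
    thus ?thesis
      by (simp add: power_mult_distrib prod.distrib flip: power_sum)
  qed
  thus ?thesis
    by (simp add: peval_def sum_distrib_left ac_simps cong: sum.cong)
qed

text \<open>Restricted to a line, a polynomial function is a polynomial in the parameter of the line, so
  it has only finitely many zeros there unless it vanishes identically.\<close>

lemma peval_on_line: "\<exists>r. \<forall>t. poly r t = peval p ((1 - t) *s a + t *s b)"
proof
  show "\<forall>t. poly (\<Sum>m\<in>Poly_Mapping.keys p. smult (Poly_Mapping.lookup p m)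
           (\<Prod>i\<in>UNIV. [:a $ i, b $ i - a $ i:] ^ Poly_Mapping.lookup m i)) t
         = peval p ((1 - t) *s a + t *s b)"
    by (simp add: peval_def poly_sum poly_prod algebra_simps)
qed


section \<open>The Zariski topology\<close>

lemma ppoint_self: "v \<in> ppoint v"
  unfolding ppoint_def by (force intro: exI[of _ 1])

lemma ppoint_scale:
  assumes "c \<noteq> 0"
  shows "ppoint (c *s v) = ppoint v"
proof -
  have "ppoint (c *s v) \<subseteq> ppoint v" if "c \<noteq> 0" for c v
    using that by (auto simp: ppoint_def vector_smult_assoc)
  from this[of c v] this[of "inverse c" "c *s v"] assms show ?thesis
    by (auto simp: vector_smult_assoc)
qed

lemma ppoint_in_basic_open:
  assumes "homogeneous d F" "v \<noteq> 0"
  shows "ppoint v \<in> basic_open F \<longleftrightarrow> peval F v \<noteq> 0"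
  using assms by (auto simp: basic_open_def proj_space_def ppoint_def peval_scale)
    (metis vector_smult_lid zero_neq_one)

lemma basic_open_mult: "basic_open (F * G) = basic_open F \<inter> basic_open G"
  by (auto simp: basic_open_def)

lemma basic_open_one: "basic_open 1 = proj_space"
  by (auto simp: basic_open_def)

lemma topspace_zariski [simp]: "topspace zariski = proj_space"
proof -
  have "basic_open 1 \<in> {basic_open F | F d. homogeneous d F}"
    using homogeneous_PConst[of 1] by (auto simp: one_eq_PConst simp del: single_one)
  moreover have "basic_open F \<subseteq> proj_space" for F
    by (auto simp: basic_open_def)
  ultimately show ?thesis
    unfolding zariski_def topology_generated_by_topspace basic_open_one by blast
qed

lemma openin_basic_open: "homogeneous d F \<Longrightarrow> openin zariski (basic_open F)"
  unfolding zariski_def by (rule topology_generated_by_Basis) blast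

text \<open>The non-vanishing loci of forms are closed under intersection, as they correspond to products
  of forms; hence they are a basis of the topology that they generate.\<close>

lemma zariski_basis:
  assumes "openin zariski W" "P \<in> W"
  obtains F d where "homogeneous d F" "P \<in> basic_open F" "basic_open F \<subseteq> W"
proof -
  have "generate_topology_on {basic_open F | F d. homogeneous d F} W"
    using assms(1) unfolding zariski_def by (rule openin_topology_generated_by)
  hence "P \<in> W \<Longrightarrow> \<exists>F d. homogeneous d F \<and> P \<in> basic_open F \<and> basic_open F \<subseteq> W"
  proof (induction rule: generate_topology_on.induct)
    case (Int A B)
    then obtain F d G e where
      "homogeneous d F" "P \<in> basic_open F" "basic_open F \<subseteq> A"
      "homogeneous e G" "P \<in> basic_open G" "basic_open G \<subseteq> B"
      by blast
    thus ?case
      by (intro exI[of _ "F * G"] exI[of _ "d + e"]) (auto simp: basic_open_mult homogeneous_mult)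
  next
    case (UN K)
    then obtain A F d where "A \<in> K" "homogeneous d F" "P \<in> basic_open F" "basic_open F \<subseteq> A"
      by blast
    thus ?case by blast
  qed auto
  thus ?thesis using assms(2) that by blast
qed

definition linear_section :: "('k::field ^ 'n::finite) set \<Rightarrow> ('k, 'n) ppoint set" where
  "linear_section V = {ppoint v | v. v \<in> V \<and> v \<noteq> 0}"

text \<open>Linear subspaces are irreducible: given two non-empty open sets, join a point of one to a
  point of the other by a line.  A form that defines an open set around either point is a non-zero
  polynomial on this line, and an infinite field has a parameter where neither form vanishes.
  The degree of \<open>G\<close> is positive so that \<open>G\<close> vanishes at the origin; thus the vector found on the
  line represents a point of projective space.\<close>

lemma basic_open_dense_in_linear_section:
  fixes V :: "('k::{field, field_char_0} ^ 'n::finite) set"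
  assumes V: "vec.subspace V" and G: "homogeneous e G" "0 < e"
    and b: "b \<in> V" "peval G b \<noteq> 0"
  shows "dense_open_in (linear_section V) (basic_open G \<inter> linear_section V)"
  unfolding dense_open_in_def
proof
  show "openin (subtopology zariski (linear_section V)) (basic_open G \<inter> linear_section V)"
    using openin_basic_open[OF G(1)] by (auto simp: openin_subtopology)
  show "linear_section V \<subseteq> zariski closure_of (basic_open G \<inter> linear_section V)"
  proof
    fix P assume "P \<in> linear_section V"
    then obtain a where a: "a \<in> V" "a \<noteq> 0" "P = ppoint a"
      by (auto simp: linear_section_def)
    have "\<exists>Q. Q \<in> basic_open G \<inter> linear_section V \<and> Q \<in> W"
      if W: "P \<in> W" "openin zariski W" for W
    proof -
      obtain F d where F: "homogeneous d F" "P \<in> basic_open F" "basic_open F \<subseteq> W"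
        using zariski_basis W by blast
      obtain r where r: "\<And>t. poly r t = peval F ((1 - t) *s a + t *s b)"
        using peval_on_line by blast
      obtain s where s: "\<And>t. poly s t = peval G ((1 - t) *s a + t *s b)"
        using peval_on_line by blast
      have "poly r 0 \<noteq> 0" using F a by (simp add: r ppoint_in_basic_open)
      moreover have "poly s 1 \<noteq> 0" using b by (simp add: s)
      ultimately have "r * s \<noteq> 0" by auto
      hence "finite {t. poly (r * s) t = 0}" by (rule poly_roots_finite)
      hence "\<exists>t. t \<notin> {t. poly (r * s) t = 0}"
        by (rule ex_new_if_finite[OF infinite_UNIV_char_0])
      then obtain t where t: "poly (r * s) t \<noteq> 0" by auto
      define w where "w = (1 - t) *s a + t *s b"
      have nz: "peval F w \<noteq> 0" "peval G w \<noteq> 0" using t by (auto simp: r s w_def)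
      have "w \<noteq> 0" using nz(2) G peval_scale[OF G(1), of 0 w] by (auto simp: zero_power)
      moreover have "w \<in> V"
        unfolding w_def by (intro vec.subspace_add vec.subspace_scale V a b)
      ultimately have "ppoint w \<in> basic_open F" "ppoint w \<in> basic_open G \<inter> linear_section V"
        using nz F(1) G(1) by (auto simp: ppoint_in_basic_open linear_section_def)
      thus ?thesis using F(3) by blast
    qed
    moreover have "P \<in> proj_space" using a by (auto simp: proj_space_def)
    ultimately show "P \<in> zariski closure_of (basic_open G \<inter> linear_section V)"
      by (auto simp: in_closure_of)
  qed
qed


section \<open>The transformation\<close>

text \<open>With \<open>v = (x, y, z)\<close>, the forms \<open>conic v\<close> and \<open>cubic \<lambda> v\<close> homogenize \<open>u = x - y\<^sup>2\<close> and
  \<open>y u - \<lambda>\<close>.  The coordinates \<open>t = y - \<lambda> / u\<close> and \<open>s = u + t\<^sup>2\<close> are thus \<open>cubic / (z * conic)\<close> and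
  \<open>(conic\<^sup>3 + cubic\<^sup>2) / (z\<^sup>2 * conic\<^sup>2)\<close>, and clearing denominators in \<open>(s : t : 1)\<close> gives the sextics.
  The coefficients lie in any commutative ring, so that the same terms denote
  field elements at a point and forms at the vector of the variables.\<close>

definition conic :: "'a::comm_ring_1 ^ 3 \<Rightarrow> 'a" where
  "conic v = v $ 1 * v $ 3 - (v $ 2)\<^sup>2"

definition cubic :: "'a::comm_ring_1 \<Rightarrow> 'a ^ 3 \<Rightarrow> 'a" where
  "cubic l v = v $ 2 * conic v - l * v $ 3 ^ 3"

definition sextics :: "'a::comm_ring_1 \<Rightarrow> 'a ^ 3 \<Rightarrow> 'a ^ 3" where
  "sextics l v = vector [conic v ^ 3 + (cubic l v)\<^sup>2, v $ 3 * conic v * cubic l v,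
     (v $ 3)\<^sup>2 * (conic v)\<^sup>2]"

definition vars :: "('k::comm_ring_1, 3) mpoly ^ 3" where
  "vars = (\<chi> i. PVar i)"

definition boundary :: "'a::comm_ring_1 ^ 3 \<Rightarrow> 'a" where
  "boundary v = v $ 3 * conic v"

definition chart :: "('k::field, 3) ppoint set" where
  "chart = basic_open (boundary vars)"

lemma peval_boundary: "peval (boundary vars) v = boundary v"
  by (simp add: boundary_def conic_def vars_def)

lemma peval_sextics: "peval (sextics (PConst l) vars $ i) v = sextics l v $ i"
  using exhaust_3[of i] by (auto simp: sextics_def conic_def cubic_def vars_def)

lemma homogeneous_vars: "homogeneous 1 (vars $ i)"
  by (simp add: vars_def homogeneous_PVar[simplified])

lemmas homogeneous_intros =
  homogeneous_add homogeneous_diff homogeneous_mult homogeneous_power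
  homogeneous_PConst homogeneous_vars

lemma homogeneous_conic: "homogeneous 2 (conic vars)"
  unfolding conic_def by (rule homogeneous_intros | simp)+

lemma homogeneous_boundary: "homogeneous 3 (boundary vars)"
  unfolding boundary_def by (rule homogeneous_intros homogeneous_conic | simp)+

lemma homogeneous_cubic: "homogeneous 3 (cubic (PConst l) vars)"
  unfolding cubic_def by (rule homogeneous_intros homogeneous_conic | simp)+

lemma homogeneous_sextics: "homogeneous 6 (sextics (PConst l) vars $ i)"
proof -
  have "homogeneous 6 (conic vars ^ 3 + (cubic (PConst l) vars)\<^sup>2)"
    "homogeneous 6 (vars $ 3 * conic vars * cubic (PConst l) vars)"
    "homogeneous 6 ((vars $ 3)\<^sup>2 * (conic vars)\<^sup>2)"
    by (rule homogeneous_intros homogeneous_conic homogeneous_cubic | simp)+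
  thus ?thesis
    using exhaust_3[of i] by (auto simp: sextics_def)
qed

text \<open>The invariance of \<open>u\<close> in homogeneous form: dividing by the square of the third sextic, which is
  \<open>z\<^sup>4 * conic\<^sup>4\<close>, leaves \<open>conic / z\<^sup>2\<close>.\<close>

lemma conic_sextics: "conic (sextics (l :: 'a::idom) v) = (v $ 3)\<^sup>2 * conic v ^ 5"
  unfolding conic_def[of "sextics l v"] unfolding sextics_def vector_3 by algebra

lemma cubic_sextics: "cubic (- l) (sextics (l :: 'a::idom) v) = v $ 2 * v $ 3 ^ 3 * conic v ^ 7"
  unfolding cubic_def[of "- l"] conic_sextics
  by (simp add: sextics_def cubic_def) algebra

lemma boundary_sextics: "boundary (sextics (l :: 'a::idom) v) = boundary v ^ 4 * conic v ^ 3"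
  unfolding boundary_def conic_sextics by (simp add: sextics_def) algebra

text \<open>Changing the sign of the parameter inverts the transformation, because \<open>t + \<lambda> / u = y\<close> and
  \<open>u + y\<^sup>2 = x\<close>.  The common factor is a power product of \<open>z\<close> and the conic, which do not vanish on the
  chart.\<close>

lemma sextics_sextics: "sextics (- l) (sextics (l :: 'a::idom) v) = (v $ 3 ^ 7 * conic v ^ 14) *s v"
proof -
  have "conic v + (v $ 2)\<^sup>2 = v $ 1 * v $ 3" by (simp add: conic_def)
  hence "((v $ 3)\<^sup>2 * conic v ^ 5) ^ 3 + (v $ 2 * v $ 3 ^ 3 * conic v ^ 7)\<^sup>2
      = v $ 3 ^ 7 * conic v ^ 14 * v $ 1"
    by algebra
  moreover have "(v $ 3)\<^sup>2 * (conic v)\<^sup>2 * ((v $ 3)\<^sup>2 * conic v ^ 5)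
      * (v $ 2 * v $ 3 ^ 3 * conic v ^ 7) = v $ 3 ^ 7 * conic v ^ 14 * v $ 2"
    by algebra
  moreover have "((v $ 3)\<^sup>2 * (conic v)\<^sup>2)\<^sup>2 * ((v $ 3)\<^sup>2 * conic v ^ 5)\<^sup>2
      = v $ 3 ^ 7 * conic v ^ 14 * v $ 3"
    by algebra
  moreover have "sextics l v $ 3 = (v $ 3)\<^sup>2 * (conic v)\<^sup>2"
    by (simp add: sextics_def)
  ultimately show ?thesis
    by (simp only: vec_eq_iff forall_3 sextics_def[of "- l"] vector_3 vector_smult_component
        conic_sextics cubic_sextics)
qed

text \<open>The union makes the map independent of a choice of coordinate vector.\<close>

definition transf :: "'k::field \<Rightarrow> ('k, 3) ppoint \<Rightarrow> ('k, 3) ppoint" where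
  "transf l P = (\<Union>v\<in>P. ppoint (sextics l v))"

lemma sextics_scale: "sextics l (c *s v) = c ^ 6 *s sextics l v" for l :: "'k::field"
  using peval_scale[OF homogeneous_sextics[of l], of _ c v]
  by (simp add: vec_eq_iff peval_sextics)

lemma transf_ppoint: "transf l (ppoint v) = ppoint (sextics l v)"
proof -
  have "ppoint (sextics l w) = ppoint (sextics l v)" if "w \<in> ppoint v" for w
    using that by (auto simp: ppoint_def[of v] sextics_scale ppoint_scale)
  thus ?thesis using ppoint_self[of v] unfolding transf_def by blast
qed

lemma in_chartE:
  assumes "P \<in> chart" obtains v where "v \<noteq> 0" "P = ppoint v" "boundary v \<noteq> 0"
proof -
  from assms obtain v where "v \<noteq> 0" "P = ppoint v"
    by (auto simp: chart_def basic_open_def proj_space_def)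
  thus ?thesis
    using that assms by (auto simp: chart_def ppoint_in_basic_open[OF homogeneous_boundary] peval_boundary)
qed

lemma ppoint_in_chart:
  assumes "boundary v \<noteq> 0" shows "ppoint v \<in> chart"
proof -
  have "v \<noteq> 0" using assms by (auto simp: boundary_def)
  thus ?thesis
    using assms by (simp add: chart_def ppoint_in_basic_open[OF homogeneous_boundary] peval_boundary)
qed

lemma transf_in_chart: "P \<in> chart \<Longrightarrow> transf l P \<in> chart"
  by (erule in_chartE)
    (auto simp: transf_ppoint boundary_sextics intro!: ppoint_in_chart, auto simp: boundary_def)

lemma transf_transf: "P \<in> chart \<Longrightarrow> transf (- l) (transf l P) = P"
  by (erule in_chartE)
    (auto simp: transf_ppoint sextics_sextics boundary_def intro!: ppoint_scale)

lemma chart_subset: "chart \<subseteq> proj_space"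
  by (auto simp: chart_def basic_open_def)

lemma regular_on_transf: "U \<subseteq> chart \<Longrightarrow> regular_on U (transf l)"
  unfolding regular_on_def
proof (intro ballI conjI)
  fix P assume "U \<subseteq> chart" "P \<in> U"
  thus "transf l P \<in> proj_space" using transf_in_chart chart_subset by blast
  show "\<exists>W d F. openin zariski W \<and> P \<in> W \<and> (\<forall>i. homogeneous d (F i)) \<and>
           (\<forall>Q\<in>W \<inter> U. \<forall>v\<in>Q. (\<chi> i. peval (F i) v) \<in> transf l Q)"
  proof (intro exI conjI)
    show "openin zariski chart"
      unfolding chart_def by (rule openin_basic_open[OF homogeneous_boundary])
    show "P \<in> chart" using \<open>U \<subseteq> chart\<close> \<open>P \<in> U\<close> by blast
    show "\<forall>i. homogeneous 6 (sextics (PConst l) vars $ i)"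
      by (simp add: homogeneous_sextics)
    show "\<forall>Q\<in>chart \<inter> U. \<forall>v\<in>Q. (\<chi> i. peval (sextics (PConst l) vars $ i) v) \<in> transf l Q"
      unfolding peval_sextics transf_def using ppoint_self by (auto simp: vec_nth_inverse)
  qed
qed

lemma regular_on_cong: "(\<And>P. P \<in> U \<Longrightarrow> \<phi> P = \<psi> P) \<Longrightarrow> regular_on U \<phi> \<longleftrightarrow> regular_on U \<psi>"
  unfolding regular_on_def by simp

text \<open>The inverse on \<open>V\<close> is again such a map, so it is regular; this covers the plane, where \<open>U\<close> and
  \<open>V\<close> are the chart, as well as the curve and the line.\<close>

lemma iso_between_transf:
  assumes U: "U \<subseteq> chart" and V: "V \<subseteq> chart"
    and iff: "\<And>P. P \<in> chart \<Longrightarrow> transf l P \<in> V \<longleftrightarrow> P \<in> U"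
  shows "iso_between U V (transf l)"
proof -
  have VU: "transf (- l) Q \<in> U" "transf l (transf (- l) Q) = Q" if "Q \<in> V" for Q
    using that V transf_transf[of Q "- l"] iff[of "transf (- l) Q"] transf_in_chart[of Q "- l"]
    by auto
  have bij: "bij_betw (transf l) U V"
    using U VU iff by (intro bij_betw_byWitness[where f' = "transf (- l)"]) (auto simp: transf_transf)
  have "inv_into U (transf l) Q = transf (- l) Q" if "Q \<in> V" for Q
    using bij VU[OF that] by (intro inv_into_f_eq) (auto simp: bij_betw_def)
  hence "regular_on V (inv_into U (transf l))"
    using regular_on_transf[OF V] regular_on_cong by blast
  thus ?thesis
    using bij regular_on_transf[OF U] by (simp add: iso_between_def)
qed


section \<open>The curve and its image\<close>

lemma subspace_first_coord: "vec.subspace {v :: 'k::field ^ 3. v $ 1 = 0}"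
  by (auto simp: vec.subspace_def)

lemma first_coord_line:
  "linear_section {v. v $ 1 = 0} = {P \<in> proj_space. \<forall>v\<in>P. v $ 1 = 0}"
  by (auto simp: linear_section_def proj_space_def ppoint_def) 
     (metis vector_smult_lid zero_neq_one)+

lemma proj_line_first_coord: "proj_line (linear_section {v :: 'k::field ^ 3. v $ 1 = 0})"
  unfolding proj_line_def first_coord_line
  by (rule exI[of _ "vector [1, 0, 0]"]) (auto simp: sum_3 vec_eq_iff forall_3)

lemma proj_space_linear_section: "proj_space = linear_section UNIV"
  by (auto simp: proj_space_def linear_section_def)

lemma dense_open_chart: "dense_open_in proj_space (chart :: ('k::{field, field_char_0}, 3) ppoint set)"
proof -
  have "peval (boundary vars) (vector [1, 0, 1] :: 'k ^ 3) \<noteq> 0"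
    by (simp add: peval_boundary) (simp add: boundary_def conic_def)
  from basic_open_dense_in_linear_section[OF vec.subspace_UNIV homogeneous_boundary _ UNIV_I this]
  have "dense_open_in proj_space (chart \<inter> proj_space :: ('k, 3) ppoint set)"
    by (simp add: chart_def proj_space_linear_section)
  thus ?thesis by (simp add: chart_subset Int_absorb2)
qed

lemma dense_open_line:
  "dense_open_in (linear_section {v. v $ 1 = 0})
     ((chart :: ('k::{field, field_char_0}, 3) ppoint set) \<inter> linear_section {v. v $ 1 = 0})"
proof -
  have "peval (boundary vars) (vector [0, 1, 1] :: 'k ^ 3) \<noteq> 0"
    by (simp add: peval_boundary) (simp add: boundary_def conic_def)
  from basic_open_dense_in_linear_section[OF subspace_first_coord homogeneous_boundary _ _ this]
  show ?thesis by (simp add: chart_def)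
qed

lemma cremona_transf: "cremona_transformation chart (transf (l :: 'k::{field, field_char_0}))"
  unfolding cremona_transformation_def maps_birationally_def
  using dense_open_chart regular_on_transf[OF subset_refl]
    iso_between_transf[OF subset_refl subset_refl, of l] transf_in_chart by blast

lemma dense_open_in_closure:
  assumes "openin zariski D" "C \<subseteq> D"
  shows "dense_open_in (zariski closure_of C) (D \<inter> zariski closure_of C)"
proof -
  have "C \<subseteq> D \<inter> zariski closure_of C"
    using assms openin_subset[OF assms(1)] closure_of_subset[of C zariski] by auto
  thus ?thesis
    using assms(1) by (auto simp: dense_open_in_def openin_subtopology intro: closure_of_mono[THEN subsetD])
qed

lemma closure_disjoint_basic_open:
  assumes "homogeneous d F" "C \<inter> basic_open F = {}"
  shows "zariski closure_of C \<inter> basic_open F = {}"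
  using openin_Int_closure_of_eq_empty[OF openin_basic_open[OF assms(1)]] assms(2) by blast

theorem proposition4p11:
  fixes lam :: "'k::{alg_closed_field, field_char_0}"
    and x y f :: "('k, 2) mpoly"
  assumes "lam \<noteq> 0"
    and "x = PVar 1" and "y = PVar 2"
    and "f = x * (x - y ^ 2) ^ 2 - 2 * PConst lam * y * (x - y ^ 2) + PConst lam ^ 2"
  shows "cremona_equivalent_to_line (affine_curve f)"
proof -
  let ?L = "linear_section {v :: 'k ^ 3. v $ 1 = 0}"
  let ?C = "affine_to_proj ` affine_curve f"
  let ?X = "zariski closure_of ?C"
  have eval_f: "peval f a = a $ 1 * (a $ 1 - (a $ 2)\<^sup>2)\<^sup>2 - 2 * lam * a $ 2 * (a $ 1 - (a $ 2)\<^sup>2) + lam\<^sup>2" for a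
    by (simp add: assms)
  \<comment> \<open>On the affine plane the first sextic is \<open>f\<close>, so in the chart it cuts out the curve.\<close>
  have sextic_f: "sextics lam (vector [a $ 1, a $ 2, 1]) $ 1 = peval f a" for a
    unfolding eval_f by (simp add: sextics_def conic_def cubic_def) algebra
  have C_chart: "?C \<subseteq> chart"
  proof
    fix P assume "P \<in> ?C"
    then obtain a where a: "P = ppoint (vector [a $ 1, a $ 2, 1])" "peval f a = 0"
      by (auto simp: affine_to_proj_def affine_curve_def)
    (* If u = 0, then f takes the value lam^2, which is not zero. *)
    have "a $ 1 - (a $ 2)\<^sup>2 \<noteq> 0"
      using a(2) assms(1) by (auto simp: eval_f)
    thus "P \<in> chart"
      unfolding a(1) by (intro ppoint_in_chart) (simp add: boundary_def conic_def)
  qed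
  have L_iff: "ppoint v \<in> ?L \<longleftrightarrow> v $ 1 = 0" if "v \<noteq> 0" for v
    using that unfolding first_coord_line by (auto simp: proj_space_def ppoint_def)
  have C_iff: "transf lam P \<in> ?L \<longleftrightarrow> P \<in> ?X" if P: "P \<in> chart" for P
  proof -
    obtain w where w: "P = ppoint w" "boundary w \<noteq> 0"
      using in_chartE[OF P] by blast
    have w3: "w $ 3 \<noteq> 0" using w by (auto simp: boundary_def)
    define a :: "'k ^ 2" where "a = vector [w $ 1 / w $ 3, w $ 2 / w $ 3]"
    define v :: "'k ^ 3" where "v = vector [a $ 1, a $ 2, 1]"
    have wv: "w = w $ 3 *s v"
      using w3 by (simp add: v_def a_def vec_eq_iff forall_3)
    have Pv: "P = ppoint v" using w3 ppoint_scale[of "w $ 3" v] w(1) wv by simp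
    have v: "v \<noteq> 0" by (auto simp: v_def vec_eq_iff forall_3)
    have "boundary v \<noteq> 0"
      using w(2) by (subst (asm) wv) (auto simp: boundary_def conic_def power2_eq_square)
    hence "boundary (sextics lam v) \<noteq> 0"
      unfolding boundary_sextics by (auto simp: boundary_def)
    hence "sextics lam v \<noteq> 0" by (auto simp: boundary_def)
    hence "transf lam P \<in> ?L \<longleftrightarrow> sextics lam v $ 1 = 0"
      by (simp add: Pv transf_ppoint L_iff)
    also have "\<dots> \<longleftrightarrow> P \<in> ?X"
    proof
      assume "sextics lam v $ 1 = 0"
      hence "P \<in> ?C"
        by (auto simp: Pv v_def sextic_f affine_to_proj_def affine_curve_def)
      thus "P \<in> ?X"
        using C_chart chart_subset closure_of_subset[of ?C zariski] by auto
    next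
      assume "P \<in> ?X"
      let ?F = "sextics (PConst lam) vars $ 1"
      have "?C \<inter> basic_open ?F = {}"
        by (auto simp: affine_curve_def affine_to_proj_def basic_open_def peval_sextics sextic_f
            dest!: bspec[OF _ ppoint_self])
      hence "P \<notin> basic_open ?F"
        using closure_disjoint_basic_open[OF homogeneous_sextics] \<open>P \<in> ?X\<close> by blast
      thus "sextics lam v $ 1 = 0"
        using v by (simp add: Pv ppoint_in_basic_open[OF homogeneous_sextics] peval_sextics)
    qed
    finally show ?thesis .
  qed
  have "iso_between (chart \<inter> ?X) (chart \<inter> ?L) (transf lam)"
    using C_iff transf_in_chart by (intro iso_between_transf) auto
  moreover have "dense_open_in ?X (chart \<inter> ?X)"
    using C_chart openin_basic_open[OF homogeneous_boundary]
    by (intro dense_open_in_closure) (simp_all add: chart_def)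
  ultimately have "maps_birationally chart (transf lam) ?X ?L"
    using dense_open_line unfolding maps_birationally_def by blast
  thus ?thesis
    using cremona_transf proj_line_first_coord
    unfolding cremona_equivalent_to_line_def proj_closure_def by blast
qed

end
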